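(* (i) For every integer $n\ge 1$ there exists a finite nilpotent group $G$ with $\operatorname{len}(G)=n$ such that for every $0<\epsilon<1$, if $k=\operatorname{len}(G)+\left\lceil\log_2\frac{1}{\epsilon}\right\rceil-2$, then $\varphi_k(G)<1-\epsilon$. (ii) For every integer $r\ge 1$ there exists a finite nilpotent group $G$ with $\operatorname{rank}(G)=r$ such that for every $0<\epsilon<1$, if $k=\operatorname{rank}(G)+\left\lceil\log_2\frac{2}{\epsilon}\right\rceil-3$, then $\varphi_k(G)<1-\epsilon$.
   Context: For a finite group $G$ and an integer $k\ge 0$, $\varphi_k(G)=N_k(G)/|G|^k$, where $N_k(G)$ is the number of $k$-tuples $(g_1,\ldots,g_k)\in G^k$ with $\langle g_1,\ldots,g_k\rangle=G$ (for $k=0$ the empty tuple generates the trivial subgroup). $\operatorname{rank}(G)$ is the minimal cardinality of a generating set of $G$. $\operatorname{len}(G)$, the chain length of $G$, is the length $n$ of any composition series $\{e\}=G_0\trianglelefteq G_1\trianglelefteq\cdots\trianglelefteq G_n=G$ with every quotient $G_i/G_{i-1}$ simple (this is independent of the series). *)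

theory Defs
  imports Complex_Main "HOL-Algebra.Algebra"
begin

fun lower_central_series :: "('a, 'b) monoid_scheme \<Rightarrow> nat \<Rightarrow> 'a set" where
  "lower_central_series G 0 = carrier G"
| "lower_central_series G (Suc i) =
     generate G {x \<otimes>\<^bsub>G\<^esub> y \<otimes>\<^bsub>G\<^esub> inv\<^bsub>G\<^esub> x \<otimes>\<^bsub>G\<^esub> inv\<^bsub>G\<^esub> y | x y.
                   x \<in> lower_central_series G i \<and> y \<in> carrier G}"

definition nilpotent_group :: "('a, 'b) monoid_scheme \<Rightarrow> bool" where
  "nilpotent_group G \<longleftrightarrow> group G \<and> (\<exists>c. lower_central_series G c = {\<one>\<^bsub>G\<^esub>})"

text \<open>Only \<open>H 0, \<dots>, H n\<close> matter. A \<^const>\<open>simple_group\<close> is non-trivial, so the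
  inclusions are strict.\<close>

definition composition_series ::
    "('a, 'b) monoid_scheme \<Rightarrow> nat \<Rightarrow> (nat \<Rightarrow> 'a set) \<Rightarrow> bool" where
  "composition_series G n H \<longleftrightarrow>
     H 0 = {\<one>\<^bsub>G\<^esub>} \<and> H n = carrier G \<and>
     (\<forall>i\<le>n. subgroup (H i) G) \<and>
     (\<forall>i<n. H i \<lhd> G\<lparr>carrier := H (Suc i)\<rparr> \<and>
            simple_group (G\<lparr>carrier := H (Suc i)\<rparr> Mod H i))"

text \<open>A finite group has a composition series, and by Jordan--Hoelder all its composition
  series have the same length, so the description below denotes that length.\<close>

definition chain_length :: "('a, 'b) monoid_scheme \<Rightarrow> nat" where
  "chain_length G = (THE n. \<exists>H. composition_series G n H)"

definition group_rank :: "('a, 'b) monoid_scheme \<Rightarrow> nat" where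
  "group_rank G =
     (LEAST r. \<exists>S. S \<subseteq> carrier G \<and> finite S \<and> card S = r \<and> generate G S = carrier G)"

definition generating_tuples :: "('a, 'b) monoid_scheme \<Rightarrow> nat \<Rightarrow> 'a list set" where
  "generating_tuples G k =
     {gs. length gs = k \<and> set gs \<subseteq> carrier G \<and> generate G (set gs) = carrier G}"

definition generating_prob :: "('a, 'b) monoid_scheme \<Rightarrow> nat \<Rightarrow> real" where
  "generating_prob G k = real (card (generating_tuples G k)) / real (order G) ^ k"

end

theory Submission
  imports Defs
begin

unbundle bit_operations_syntax

text \<open>Both parts are witnessed by \<open>G = C\<^sub>2\<^sup>n\<close>, whose chain length and rank are both \<open>n\<close>.
  Write \<open>n = m + 1\<close> and view a \<open>k\<close>-tuple in \<open>G\<close> as a \<open>k\<close>-tuple \<open>hs\<close> in \<open>C\<^sub>2\<^sup>m\<close> together with a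
  last column in \<open>C\<^sub>2\<^sup>k\<close>. If \<open>hs\<close> does not generate \<open>C\<^sub>2\<^sup>m\<close>, no last column makes the tuple
  generating. If it does, the \<open>2\<^sup>m\<close> characters of \<open>C\<^sub>2\<^sup>m\<close> restrict to distinct last columns, and
  for each of them the tuple lies in the graph of a character, a proper subgroup. So for
  \<open>k \<ge> m\<close> at most a fraction \<open>1 - 2\<^sup>m / 2\<^sup>k\<close> of all tuples generates \<open>G\<close>.\<close>

section \<open>Elementary abelian 2-groups on binary numbers\<close>

text \<open>Coordinates are binary digits, so one type serves every \<open>n\<close>, smaller groups
  are initial segments of larger ones, and \<open>take_bit\<close> is the projection onto
  them.\<close>

definition xor_group :: "nat \<Rightarrow> nat monoid" where
  "xor_group n = \<lparr>carrier = {..<2 ^ n}, monoid.mult = (XOR), one = 0\<rparr>"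

lemma xor_group_simps [simp]:
  "carrier (xor_group n) = {..<2 ^ n}" "x \<otimes>\<^bsub>xor_group n\<^esub> y = x XOR y" "\<one>\<^bsub>xor_group n\<^esub> = 0"
  by (simp_all add: xor_group_def)

lemma xor_less_exp:
  fixes x y :: nat
  assumes "x < 2 ^ n" "y < 2 ^ n"
  shows "x XOR y < 2 ^ n"
  using assms by (simp flip: take_bit_nat_eq_self_iff)

lemma comm_group_xor_group: "comm_group (xor_group n)"
proof (rule comm_groupI)
  show "\<exists>y\<in>carrier (xor_group n). y \<otimes>\<^bsub>xor_group n\<^esub> x = \<one>\<^bsub>xor_group n\<^esub>"
    if "x \<in> carrier (xor_group n)" for x
    using that by (intro bexI [of _ x]) simp_all
qed (auto simp: xor_less_exp ac_simps)

lemma group_xor_group: "group (xor_group n)"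
  using comm_group_xor_group comm_group.axioms(2) by blast

lemma inv_xor_group: "x < 2 ^ n \<Longrightarrow> inv\<^bsub>xor_group n\<^esub> x = x"
  using group.inv_equality [OF group_xor_group [of n], of x x] by simp

lemma order_xor_group: "order (xor_group n) = 2 ^ n"
  by (simp add: order_def)

lemma subgroup_xor_groupI:
  assumes "I \<subseteq> {..<2 ^ n}" "0 \<in> I" "\<And>x y. x \<in> I \<Longrightarrow> y \<in> I \<Longrightarrow> x XOR y \<in> I"
  shows "subgroup I (xor_group n)"
proof (rule group.subgroupI [OF group_xor_group])
  show "inv\<^bsub>xor_group n\<^esub> x \<in> I" if "x \<in> I" for x
    using that assms(1) inv_xor_group [of x n] by auto
qed (use assms in auto)

text \<open>All commutators vanish, so the series reaches the trivial subgroup at index 1.\<close>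

lemma nilpotent_xor_group: "nilpotent_group (xor_group n)"
proof -
  let ?C = "{x \<otimes>\<^bsub>xor_group n\<^esub> y \<otimes>\<^bsub>xor_group n\<^esub> inv\<^bsub>xor_group n\<^esub> x \<otimes>\<^bsub>xor_group n\<^esub> inv\<^bsub>xor_group n\<^esub> y | x y.
                   x \<in> lower_central_series (xor_group n) 0 \<and> y \<in> carrier (xor_group n)}"
  have "((x XOR y) XOR x) XOR y = 0" for x y :: nat
    by (rule bit_eqI) (auto simp: bit_xor_iff)
  then have "?C \<subseteq> {\<one>\<^bsub>xor_group n\<^esub>}"
    by (auto simp: inv_xor_group)
  then have "generate (xor_group n) ?C \<subseteq> {\<one>\<^bsub>xor_group n\<^esub>}"
    by (intro group.generate_subgroup_incl [OF group_xor_group] group.triv_subgroup [OF group_xor_group])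
  moreover have "\<one>\<^bsub>xor_group n\<^esub> \<in> generate (xor_group n) ?C"
    by (rule generate.one)
  ultimately have "lower_central_series (xor_group n) (Suc 0) = {\<one>\<^bsub>xor_group n\<^esub>}"
    by auto
  with group_xor_group show ?thesis
    unfolding nilpotent_group_def by blast
qed

section \<open>Chain length\<close>

text \<open>Self-inverse elements commute, so for \<open>x\<close> other than the identity the
  subgroup \<open>{\<one>, x}\<close> is normal, and simplicity makes it the whole group.\<close>

lemma (in group) order_simple_exponent_two:
  assumes "simple_group G" and sq: "\<And>x. x \<in> carrier G \<Longrightarrow> x \<otimes> x = \<one>"
  shows "order G = 2"
proof -
  interpret simple_group G by fact
  have inv: "inv x = x" if "x \<in> carrier G" for x
    using that sq by (simp add: inv_equality)
  interpret comm_group G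
  proof (rule group_comm_groupI)
    fix x y assume xy: "x \<in> carrier G" "y \<in> carrier G"
    then have "inv (x \<otimes> y) = inv y \<otimes> inv x"
      by (rule inv_mult_group)
    with xy show "x \<otimes> y = y \<otimes> x"
      by (simp add: inv)
  qed
  obtain x where x: "x \<in> carrier G" "x \<noteq> \<one>"
    using simple_not_triv one_closed by blast
  have "subgroup {\<one>, x} G"
    by (rule subgroupI) (use x sq inv in auto)
  then have "{\<one>, x} = carrier G"
    using no_real_normal_subgroup subgroup_imp_normal x by blast
  then have "order G = card {\<one>, x}"
    by (simp add: order_def)
  with x show ?thesis by simp
qed

text \<open>Every factor is simple and inherits exponent two, hence has order 2, and Lagrange
  doubles the size at each step. At \<open>i = l\<close> this fixes the length of every series, as
  the \<open>THE\<close> in \<open>chain_length\<close> demands.\<close>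

lemma composition_series_xor_group_card:
  assumes "composition_series (xor_group n) l H" "i \<le> l"
  shows "card (H i) = 2 ^ i"
  using assms(2)
proof (induction i)
  case 0
  then show ?case using assms(1) by (simp add: composition_series_def)
next
  case (Suc i)
  let ?K = "xor_group n\<lparr>carrier := H (Suc i)\<rparr>"
  have nrm: "H i \<lhd> ?K" and simple: "simple_group (?K Mod H i)"
    and sub: "subgroup (H (Suc i)) (xor_group n)"
    using assms(1) Suc.prems by (auto simp: composition_series_def)
  interpret N: normal "H i" ?K by fact
  interpret Q: group "?K Mod H i" by (rule N.factorgroup_is_group)
  have "H (Suc i) \<subseteq> {..<2 ^ n}"
    using subgroup.subset [OF sub] by simp
  have "order (?K Mod H i) = 2"
  proof (rule Q.order_simple_exponent_two [OF simple])
    fix x assume "x \<in> carrier (?K Mod H i)"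
    then obtain g where g: "g \<in> carrier ?K" "x = H i #>\<^bsub>?K\<^esub> g"
      by (auto simp: FactGroup_def RCOSETS_def)
    then have "x <#>\<^bsub>?K\<^esub> x = H i #>\<^bsub>?K\<^esub> (g \<otimes>\<^bsub>?K\<^esub> g)"
      using N.rcos_sum by blast
    also have "\<dots> = H i"
      using N.coset_mult_one [OF N.subset] by simp
    finally show "x \<otimes>\<^bsub>?K Mod H i\<^esub> x = \<one>\<^bsub>?K Mod H i\<^esub>"
      by (simp add: FactGroup_def)
  qed
  then have "card (rcosets\<^bsub>?K\<^esub> H i) = 2"
    by (simp add: FactGroup_def order_def)
  with N.lagrange [OF N.subgroup_axioms] Suc show ?case
    by (simp add: order_def)
qed

lemma composition_series_xor_group: "composition_series (xor_group n) n (\<lambda>i. {..<2 ^ i})"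
proof -
  have sub: "subgroup {..<2 ^ i} (xor_group n)" if "i \<le> n" for i
    by (rule subgroup_xor_groupI) (use that in \<open>auto simp: xor_less_exp power_increasing intro: less_le_trans\<close>)
  have "{..<2 ^ i} \<lhd> xor_group n\<lparr>carrier := {..<2 ^ Suc i}\<rparr> \<and>
      simple_group (xor_group n\<lparr>carrier := {..<2 ^ Suc i}\<rparr> Mod {..<2 ^ i})" if "i < n" for i
  proof -
    let ?K = "xor_group n\<lparr>carrier := {..<2 ^ Suc i}\<rparr>"
    \<comment> \<open>Shrinking the carrier gives literally the smaller group, so its commutativity
      is available.\<close>
    have K: "?K = xor_group (Suc i)"
      by (simp add: xor_group_def)
    have s: "subgroup {..<2 ^ i} ?K"
      unfolding K by (rule subgroup_xor_groupI) (auto simp: xor_less_exp)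
    then have nrm: "{..<2 ^ i} \<lhd> ?K"
      unfolding K by (rule comm_group.subgroup_imp_normal [OF comm_group_xor_group])
    interpret N: normal "{..<2 ^ i}" ?K by (rule nrm)
    have "card (rcosets\<^bsub>?K\<^esub> {..<2 ^ i}) * 2 ^ i = 2 * 2 ^ i"
      using N.lagrange [OF s] by (simp add: order_def)
    then have "order (?K Mod {..<2 ^ i}) = 2"
      by (simp add: FactGroup_def order_def)
    then show ?thesis
      using nrm group.prime_order_simple [OF N.factorgroup_is_group] two_is_prime_nat by simp
  qed
  with sub show ?thesis
    by (auto simp: composition_series_def)
qed

lemma chain_length_xor_group: "chain_length (xor_group n) = n"
  unfolding chain_length_def
proof (rule the_equality)
  show "\<exists>H. composition_series (xor_group n) n H"
    using composition_series_xor_group by blast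
  fix l assume "\<exists>H. composition_series (xor_group n) l H"
  then obtain H where H: "composition_series (xor_group n) l H" by blast
  then have "card (carrier (xor_group n)) = 2 ^ l"
    using composition_series_xor_group_card [OF H, of l] by (simp add: composition_series_def)
  then show "l = n" by simp
qed

section \<open>Characters and proper subgroups\<close>

lemma nat_eqI_bits:
  fixes v w :: nat
  assumes "v < 2 ^ m" "w < 2 ^ m" "\<And>i. i < m \<Longrightarrow> bit v i = bit w i"
  shows "v = w"
proof -
  have "take_bit m v = take_bit m w"
    using assms(3) by (intro bit_eqI) (auto simp: bit_take_bit_iff)
  with assms(1,2) show ?thesis by (simp add: take_bit_nat_eq_self)
qed

text \<open>The character with index \<open>v\<close>: the inner product over the two-element field
  of the lowest \<open>m\<close> digits of \<open>v\<close> and \<open>g\<close>, with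
  \<open>\<noteq>\<close> on truth values as addition.\<close>

primrec xor_char :: "nat \<Rightarrow> nat \<Rightarrow> nat \<Rightarrow> bool" where
  "xor_char 0 v g = False"
| "xor_char (Suc m) v g = (xor_char m v g \<noteq> (bit v m \<and> bit g m))"

lemma xor_char_xor: "xor_char m v (g XOR h) = (xor_char m v g \<noteq> xor_char m v h)"
  by (induction m) (auto simp: bit_xor_iff)

lemma xor_char_0 [simp]: "\<not> xor_char m v 0"
  by (induction m) auto

text \<open>Values on the standard basis read off the digits of \<open>v\<close>; this is what
  separates characters.\<close>

lemma xor_char_exp: "xor_char m v (2 ^ i) \<longleftrightarrow> i < m \<and> bit v i"
  by (induction m) (auto simp: bit_exp_iff less_Suc_eq)

lemma xor_char_take_bit: "j \<le> m \<Longrightarrow> xor_char j v (take_bit m g) = xor_char j v g"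
  by (induction j) (auto simp: bit_take_bit_iff)

definition add_top_bit :: "nat \<Rightarrow> nat \<Rightarrow> bool \<Rightarrow> nat" where
  "add_top_bit m h b = (if b then 2 ^ m + h else h)"

lemma take_bit_add_top_bit: "h < 2 ^ m \<Longrightarrow> take_bit m (add_top_bit m h b) = h"
  by (simp add: add_top_bit_def take_bit_eq_mod)

lemma bit_add_top_bit: "h < 2 ^ m \<Longrightarrow> bit (add_top_bit m h b) m = b"
  by (simp add: add_top_bit_def bit_iff_odd)

lemma add_top_bit_less: "h < 2 ^ m \<Longrightarrow> add_top_bit m h b < 2 ^ Suc m"
  by (simp add: add_top_bit_def)

text \<open>The graph of a character is a subgroup because characters are additive.\<close>

lemma generate_neq_carrier_graph:
  assumes "S \<subseteq> {..<2 ^ Suc m}" "\<And>g. g \<in> S \<Longrightarrow> bit g m = xor_char m v g"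
  shows "generate (xor_group (Suc m)) S \<noteq> carrier (xor_group (Suc m))"
proof -
  let ?P = "{g. g < 2 ^ Suc m \<and> bit g m = xor_char m v g}"
  have "subgroup ?P (xor_group (Suc m))"
    by (rule subgroup_xor_groupI)
      (auto simp: xor_char_xor bit_xor_iff simp del: power_Suc intro: xor_less_exp)
  then have "generate (xor_group (Suc m)) S \<subseteq> ?P"
    using assms by (intro group.generate_subgroup_incl [OF group_xor_group]) auto
  \<comment> \<open>The lower digits of \<open>2 ^ m\<close> are zero, so the character vanishes
    there, yet the top digit is set.\<close>
  moreover have "2 ^ m \<notin> ?P"
    by (simp add: xor_char_exp bit_exp_iff)
  moreover have "2 ^ m \<in> carrier (xor_group (Suc m))"
    by simp
  ultimately show ?thesis by blast
qed

text \<open>The preimage of a proper subgroup under the projection is again a proper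
  subgroup.\<close>

lemma generate_neq_carrier_take_bit:
  assumes "S \<subseteq> {..<2 ^ Suc m}"
    and "generate (xor_group m) (take_bit m ` S) \<noteq> carrier (xor_group m)"
  shows "generate (xor_group (Suc m)) S \<noteq> carrier (xor_group (Suc m))"
proof -
  let ?T = "take_bit m ` S"
  let ?P = "{g. g < 2 ^ Suc m \<and> take_bit m g \<in> generate (xor_group m) ?T}"
  have T: "?T \<subseteq> carrier (xor_group m)"
    by auto
  interpret T: subgroup "generate (xor_group m) ?T" "xor_group m"
    by (rule group.generate_is_subgroup [OF group_xor_group T])
  have "subgroup ?P (xor_group (Suc m))"
    using T.m_closed T.one_closed
    by (intro subgroup_xor_groupI) (auto simp del: power_Suc intro: xor_less_exp)
  then have "generate (xor_group (Suc m)) S \<subseteq> ?P"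
    using assms(1) by (intro group.generate_subgroup_incl [OF group_xor_group])
      (auto intro: generate.incl)
  moreover obtain h where "h < 2 ^ m" "h \<notin> generate (xor_group m) ?T"
    using assms(2) T.subset by auto
  then have "h \<notin> ?P" "h \<in> carrier (xor_group (Suc m))"
    by (auto simp: take_bit_nat_eq_self)
  ultimately show ?thesis by blast
qed

text \<open>Two characters agree on a subgroup; once it contains generators it contains each
  \<open>2 ^ i\<close>, where they reveal their indices.\<close>

lemma xor_char_eq_on_generators:
  assumes "generate (xor_group m) S = carrier (xor_group m)" "S \<subseteq> {..<2 ^ m}"
    and "v < 2 ^ m" "w < 2 ^ m" "\<And>g. g \<in> S \<Longrightarrow> xor_char m v g = xor_char m w g"
  shows "v = w"
proof (rule nat_eqI_bits [OF assms(3,4)])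
  fix i assume "i < m"
  let ?P = "{g. g < 2 ^ m \<and> xor_char m v g = xor_char m w g}"
  have "subgroup ?P (xor_group m)"
    by (rule subgroup_xor_groupI) (auto simp: xor_char_xor intro: xor_less_exp)
  then have "generate (xor_group m) S \<subseteq> ?P"
    using assms by (intro group.generate_subgroup_incl [OF group_xor_group]) auto
  with assms(1) \<open>i < m\<close> have "2 ^ i \<in> ?P"
    by auto
  with \<open>i < m\<close> show "bit v i = bit w i"
    by (simp add: xor_char_exp)
qed

section \<open>Counting tuples that do not generate\<close>

text \<open>The \<open>2 ^ (m * k)\<close> lower tuples \<open>hs\<close>, each paired with
  \<open>2 ^ m\<close> indices \<open>v\<close>, inject into the nongenerating tuples via
  \<open>F\<close>.\<close>

lemma card_nongenerating_tuples_ge: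
  assumes "m \<le> k"
  shows "2 ^ (m * Suc k) \<le> card {gs. set gs \<subseteq> {..<2 ^ Suc m} \<and> length gs = k \<and>
           generate (xor_group (Suc m)) (set gs) \<noteq> carrier (xor_group (Suc m))}"
    (is "_ \<le> card ?N")
proof -
  (* If hs does not generate, any injection of {..<2^m} into the last columns would do. *)
  define f where "f hs v =
    (if generate (xor_group m) (set hs) = carrier (xor_group m)
     then map (xor_char m v) hs else map (bit v) [0..<k])" for hs v
  define F where "F p = (case p of (hs, v) \<Rightarrow> map2 (add_top_bit m) hs (f hs v))" for p
  let ?L = "{hs :: nat list. set hs \<subseteq> {..<2 ^ m} \<and> length hs = k}"
  have len: "length (f hs v) = k" if "hs \<in> ?L" for hs v
    using that by (simp add: f_def)
  \<comment> \<open>\<open>low\<close> and \<open>top\<close> recover \<open>hs\<close> and the last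
    column from \<open>F (hs, v)\<close>; injectivity and non-generation both rest on them.\<close>
  have low: "map (take_bit m) (F (hs, v)) = hs" if "hs \<in> ?L" for hs v
    using that len [OF that, of v]
    by (auto simp: F_def list_eq_iff_nth_eq subset_iff intro!: take_bit_add_top_bit)
  have top: "map (\<lambda>g. bit g m) (F (hs, v)) = f hs v" if "hs \<in> ?L" for hs v
    using that len [OF that, of v]
    by (auto simp: F_def list_eq_iff_nth_eq subset_iff intro!: bit_add_top_bit)
  have inj_f: "v = w" if "hs \<in> ?L" "v < 2 ^ m" "w < 2 ^ m" "f hs v = f hs w" for hs v w
  proof (cases "generate (xor_group m) (set hs) = carrier (xor_group m)")
    case True
    show ?thesis
      by (rule xor_char_eq_on_generators [OF True]) (use that True in \<open>auto simp: f_def\<close>)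
  next
    case False
    \<comment> \<open>Since \<open>m \<le> k\<close>, the column of length \<open>k\<close> holds
      all digits of an index below \<open>2 ^ m\<close>.\<close>
    show ?thesis
      by (rule nat_eqI_bits) (use that False assms in \<open>auto simp: f_def\<close>)
  qed
  have "inj_on F (?L \<times> {..<2 ^ m})"
  proof (rule inj_onI)
    fix p p' assume p: "p \<in> ?L \<times> {..<2 ^ m}" "p' \<in> ?L \<times> {..<2 ^ m}" and eq: "F p = F p'"
    obtain hs v hs' v' where p_eq: "p = (hs, v)" "p' = (hs', v')"
      by (cases p, cases p')
    have hs: "hs \<in> ?L" "hs' \<in> ?L" and v: "v < 2 ^ m" "v' < 2 ^ m"
      using p unfolding p_eq by blast+
    have "hs = hs'"
      using low [OF hs(1), of v] low [OF hs(2), of v'] eq unfolding p_eq by metis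
    moreover from this have "f hs v = f hs v'"
      using top [OF hs(1), of v] top [OF hs(2), of v'] eq unfolding p_eq by metis
    then have "v = v'"
      using inj_f [OF hs(1) v] by blast
    ultimately show "p = p'"
      unfolding p_eq by blast
  qed
  moreover have "F ` (?L \<times> {..<2 ^ m}) \<subseteq> ?N"
  proof clarify
    fix hs :: "nat list" and v :: nat
    assume L: "set hs \<subseteq> {..<2 ^ m}" "k = length hs"
    let ?S = "set (F (hs, v))"
    have sub: "?S \<subseteq> {..<2 ^ Suc m}"
      using L by (auto simp: F_def simp del: power_Suc dest!: set_zip_leftD intro!: add_top_bit_less)
    have "generate (xor_group (Suc m)) ?S \<noteq> carrier (xor_group (Suc m))"
    proof (cases "generate (xor_group m) (set hs) = carrier (xor_group m)")
      case True
      \<comment> \<open>Entry by entry, the top digit is the character value of the lower digits: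
        the tuple lies in the graph.\<close>
      have "map (\<lambda>g. bit g m) (F (hs, v)) = map (xor_char m v) (map (take_bit m) (F (hs, v)))"
        using L True top [of hs v] low [of hs v] by (simp add: f_def)
      then have "bit g m = xor_char m v g" if "g \<in> ?S" for g
        using that by (simp add: xor_char_take_bit)
      with sub show ?thesis by (rule generate_neq_carrier_graph)
    next
      case False
      have "take_bit m ` ?S = set hs"
        using L low [of hs v] by (metis (mono_tags, lifting) list.set_map mem_Collect_eq)
      with False sub show ?thesis by (intro generate_neq_carrier_take_bit) simp_all
    qed
    with sub L len [of hs v] show "set (F (hs, v)) \<subseteq> {..<2 ^ Suc m} \<and> length (F (hs, v)) = length hs \<and>
        generate (xor_group (Suc m)) ?S \<noteq> carrier (xor_group (Suc m))"
      by (simp add: F_def)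
  qed
  moreover have "finite ?N"
    by (rule finite_subset [OF _ finite_lists_length_eq [of "{..<2 ^ Suc m}" k]]) auto
  ultimately have "card (?L \<times> {..<2 ^ m :: nat}) \<le> card ?N"
    by (rule card_inj_on_le)
  moreover have "card (?L \<times> {..<2 ^ m :: nat}) = 2 ^ (m * Suc k)"
    by (simp add: card_cartesian_product card_lists_length_eq power_add power_mult)
  ultimately show ?thesis by simp
qed

text \<open>Generating and nongenerating tuples partition all \<open>2 ^ (Suc m * k)\<close> tuples,
  and \<open>2 ^ (m * Suc k)\<close> of these are the fraction \<open>2 ^ m / 2 ^ k\<close>.\<close>

lemma generating_prob_xor_group_le:
  assumes "m \<le> k"
  shows "generating_prob (xor_group (Suc m)) k \<le> 1 - 2 ^ m / 2 ^ k"
proof -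
  let ?L = "{gs :: nat list. set gs \<subseteq> {..<2 ^ Suc m} \<and> length gs = k}"
  let ?N = "{gs. set gs \<subseteq> {..<2 ^ Suc m} \<and> length gs = k \<and>
           generate (xor_group (Suc m)) (set gs) \<noteq> carrier (xor_group (Suc m))}"
  let ?G = "generating_tuples (xor_group (Suc m)) k"
  have fin: "finite ?L"
    by (rule finite_lists_length_eq) simp
  have "card (?G \<union> ?N) = card ?G + card ?N"
    by (intro card_Un_disjoint finite_subset [OF _ fin]) (auto simp: generating_tuples_def)
  moreover have "?G \<union> ?N = ?L"
    by (auto simp: generating_tuples_def)
  moreover have "card ?L = (2 ^ Suc m) ^ k"
    by (subst card_lists_length_eq) simp_all
  ultimately have total: "card ?G + card ?N = (2 ^ Suc m) ^ k"
    by metis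
  have "card ?G + 2 ^ (m * Suc k) \<le> card ?G + card ?N"
    using card_nongenerating_tuples_ge [OF assms] by (rule add_left_mono)
  also note total
  finally have "real (card ?G + 2 ^ (m * Suc k)) \<le> real ((2 ^ Suc m) ^ k)"
    by (rule of_nat_mono)
  then have "real (card ?G) \<le> (2 ^ Suc m) ^ k - 2 ^ (m * Suc k)"
    by simp
  also have "\<dots> = (1 - 2 ^ m / 2 ^ k) * (2 ^ Suc m) ^ k"
    by (simp add: field_simps power_add power_mult_distrib flip: power_mult)
  finally show ?thesis
    by (simp add: generating_prob_def order_xor_group divide_le_eq)
qed

section \<open>Rank\<close>

text \<open>Every number is the XOR of its binary digits, assembled here one digit at a time by
  \<open>take_bit\<close>.\<close>

lemma generate_exps_xor_group:
  "generate (xor_group n) ((^) 2 ` {..<n}) = carrier (xor_group n)"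
proof (rule antisym)
  let ?S = "(^) 2 ` {..<n} :: nat set"
  have S: "?S \<subseteq> carrier (xor_group n)"
    by auto
  interpret S: subgroup "generate (xor_group n) ?S" "xor_group n"
    by (rule group.generate_is_subgroup [OF group_xor_group S])
  show "generate (xor_group n) ?S \<subseteq> carrier (xor_group n)"
    by (rule S.subset)
  have "take_bit j x \<in> generate (xor_group n) ?S" if "j \<le> n" for j x :: nat
    using that
  proof (induction j)
    case 0
    then show ?case using S.one_closed by simp
  next
    case (Suc j)
    have "take_bit (Suc j) x = take_bit j x XOR (if bit x j then 2 ^ j else 0)"
      by (rule bit_eqI) (auto simp: bit_xor_iff bit_take_bit_iff bit_exp_iff less_Suc_eq)
    moreover have "(if bit x j then 2 ^ j else 0) \<in> generate (xor_group n) ?S"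
      using Suc.prems S.one_closed by (auto intro: generate.incl)
    ultimately show ?case
      using Suc S.m_closed by simp
  qed
  from this [of n] show "carrier (xor_group n) \<subseteq> generate (xor_group n) ?S"
    by (metis lessThan_iff order_refl subsetI take_bit_nat_eq_self_iff xor_group_simps(1))
qed

text \<open>The lower bound reuses the probability estimate: fewer than \<open>n\<close> generators
  would yield a generating tuple of length \<open>n - 1\<close>, where the estimate gives
  probability 0.\<close>

lemma group_rank_xor_group: "group_rank (xor_group n) = n"
  unfolding group_rank_def
proof (rule Least_equality)
  have "card ((^) 2 ` {..<n} :: nat set) = n"
    by (subst card_image) (auto simp: inj_on_def)
  then show "\<exists>S\<subseteq>carrier (xor_group n). finite S \<and> card S = n \<and> generate (xor_group n) S = carrier (xor_group n)"
    using generate_exps_xor_group by (intro exI [of _ "(^) 2 ` {..<n}"]) auto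
  fix r
  assume "\<exists>S\<subseteq>carrier (xor_group n). finite S \<and> card S = r \<and> generate (xor_group n) S = carrier (xor_group n)"
  then obtain S where S: "S \<subseteq> {..<2 ^ n}" "finite S" "card S = r"
    "generate (xor_group n) S = carrier (xor_group n)"
    by auto
  show "n \<le> r"
  proof (rule ccontr)
    assume "\<not> n \<le> r"
    then obtain m where m: "n = Suc m" "r \<le> m"
      by (cases n) auto
    obtain xs where xs: "set xs = S" "distinct xs"
      using finite_distinct_list [OF \<open>finite S\<close>] by blast
    \<comment> \<open>Padding with the identity brings the length to exactly \<open>m\<close> and
      keeps the tuple generating.\<close>
    let ?gs = "xs @ replicate (m - r) 0"
    have "length xs = r"
      using xs S distinct_card by fastforce
    have sub: "set ?gs \<subseteq> carrier (xor_group n)"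
      using S xs by auto
    then have "generate (xor_group n) (set ?gs) \<subseteq> carrier (xor_group n)"
      by (rule group.generate_incl [OF group_xor_group])
    moreover have "generate (xor_group n) S \<subseteq> generate (xor_group n) (set ?gs)"
      using xs by (intro group.mono_generate [OF group_xor_group]) auto
    ultimately have "?gs \<in> generating_tuples (xor_group n) m"
      using sub S m \<open>length xs = r\<close> by (auto simp: generating_tuples_def)
    moreover have "finite (generating_tuples (xor_group n) m)"
      by (rule finite_subset [OF _ finite_lists_length_eq [of "{..<2 ^ n}" m]])
        (auto simp: generating_tuples_def)
    ultimately have "card (generating_tuples (xor_group n) m) > 0"
      using card_gt_0_iff by blast
    then have "generating_prob (xor_group n) m > 0"
      by (simp add: generating_prob_def order_xor_group)
    with generating_prob_xor_group_le [of m m] m show False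
      by simp
  qed
qed

section \<open>The threshold for the number of elements\<close>

text \<open>With \<open>n = Suc m\<close>, the excess \<open>k - m\<close> is the ceiling minus 1,
  hence strictly below the logarithm; this yields the strict inequality.\<close>

lemma generating_prob_xor_group_less:
  fixes \<epsilon> :: real
  assumes "n \<ge> 1" "0 < \<epsilon>" "\<epsilon> < 1" and k: "int k = int n + \<lceil>log 2 (1 / \<epsilon>)\<rceil> - 2"
  shows "generating_prob (xor_group n) k < 1 - \<epsilon>"
proof -
  obtain m where n: "n = Suc m"
    using \<open>n \<ge> 1\<close> by (cases n) auto
  have "log 2 (1 / \<epsilon>) > 0"
    using assms by simp
  \<comment> \<open>The bound \<open>\<epsilon> < 1\<close> enters here: it forces
    \<open>m \<le> k\<close>, so \<open>k - m\<close> is not truncated and the estimate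
    applies.\<close>
  then have "\<lceil>log 2 (1 / \<epsilon>)\<rceil> \<ge> 1"
    by linarith
  with k n have "m \<le> k"
    by linarith
  have "real (k - m) = \<lceil>log 2 (1 / \<epsilon>)\<rceil> - 1"
    using k n \<open>m \<le> k\<close> by linarith
  then have "real (k - m) < log 2 (1 / \<epsilon>)"
    by linarith
  then have "2 ^ (k - m) < 1 / \<epsilon>"
    using assms by (simp add: less_log_iff powr_realpow)
  then have "\<epsilon> < 1 / 2 ^ (k - m)"
    using assms by (simp add: field_simps)
  also have "\<dots> = 2 ^ m / 2 ^ k"
    using \<open>m \<le> k\<close> by (simp add: power_diff)
  finally show ?thesis
    using generating_prob_xor_group_le [OF \<open>m \<le> k\<close>] n by simp
qed

theorem theorem4:
  shows
    "(\<forall>n::nat. n \<ge> 1 \<longrightarrow>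
        (\<exists>G :: nat monoid.
           finite (carrier G) \<and> nilpotent_group G \<and> chain_length G = n \<and>
           (\<forall>\<epsilon>::real. 0 < \<epsilon> \<and> \<epsilon> < 1 \<longrightarrow>
              (\<forall>k::nat. int k = int (chain_length G) + \<lceil>log 2 (1 / \<epsilon>)\<rceil> - 2 \<longrightarrow>
                 generating_prob G k < 1 - \<epsilon>))))
     \<and>
     (\<forall>r::nat. r \<ge> 1 \<longrightarrow>
        (\<exists>G :: nat monoid.
           finite (carrier G) \<and> nilpotent_group G \<and> group_rank G = r \<and>
           (\<forall>\<epsilon>::real. 0 < \<epsilon> \<and> \<epsilon> < 1 \<longrightarrow>
              (\<forall>k::nat. int k = int (group_rank G) + \<lceil>log 2 (2 / \<epsilon>)\<rceil> - 3 \<longrightarrow>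
                 generating_prob G k < 1 - \<epsilon>))))"
proof (intro conjI allI impI)
  fix n :: nat assume n: "n \<ge> 1"
  show "\<exists>G :: nat monoid.
           finite (carrier G) \<and> nilpotent_group G \<and> chain_length G = n \<and>
           (\<forall>\<epsilon>::real. 0 < \<epsilon> \<and> \<epsilon> < 1 \<longrightarrow>
              (\<forall>k::nat. int k = int (chain_length G) + \<lceil>log 2 (1 / \<epsilon>)\<rceil> - 2 \<longrightarrow>
                 generating_prob G k < 1 - \<epsilon>))"
    using n generating_prob_xor_group_less
    by (intro exI [of _ "xor_group n"]) (simp add: nilpotent_xor_group chain_length_xor_group)
next
  fix r :: nat assume r: "r \<ge> 1"
  \<comment> \<open>The extra 1 passes through the ceiling and turns the offset 3 into 2, so both
    parts use the same inequality.\<close>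
  have "log 2 (2 / \<epsilon>) = log 2 (1 / \<epsilon>) + 1" if "0 < \<epsilon>" for \<epsilon> :: real
    using that by (simp add: log_divide)
  with r show "\<exists>G :: nat monoid.
           finite (carrier G) \<and> nilpotent_group G \<and> group_rank G = r \<and>
           (\<forall>\<epsilon>::real. 0 < \<epsilon> \<and> \<epsilon> < 1 \<longrightarrow>
              (\<forall>k::nat. int k = int (group_rank G) + \<lceil>log 2 (2 / \<epsilon>)\<rceil> - 3 \<longrightarrow>
                 generating_prob G k < 1 - \<epsilon>))"
    by (intro exI [of _ "xor_group r"])
      (auto simp: nilpotent_xor_group group_rank_xor_group intro!: generating_prob_xor_group_less)
qed

end
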